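(* Consider the associated family of stationary surfaces with parameters $t\in(-1,1)$ and $\lambda\in\mathbb{C}\setminus\{0\}$ given by $$\mathbf{x}=2\,\mathrm{Re}\int(\phi+\psi,-\mathrm{i}(\phi-\psi),1-\phi\psi,1+\phi\psi)\,\mathrm{d}h,\quad \phi=z+t,\ \psi=\frac{-1}{z-t},\ \mathrm{d}h=\lambda\frac{z-t}{z^2}\,\mathrm{d}z .$$ The generalized catenoids ($\lambda$ real) and the generalized helicoids ($\lambda$ purely imaginary) are embedded. Any other stationary surface in this family ($\lambda$ neither real nor purely imaginary) has self-intersection points; indeed, in that case, on the universal covering one has a simply connected stationary surface whose unique end is not an embedded end.
   Context: $\mathbb{R}^4_1$ is $\mathbb{R}^4$ with $\langle \mathbf{x},\mathbf{x}\rangle=x_1^2+x_2^2+x_3^2-x_4^2$; a stationary surface is a spacelike immersed surface with zero mean curvature vector. Explicitly (up to translation) $$\mathbf{x}=2\,\mathrm{Re}\Big[\lambda\Big(z+\tfrac{t^2+1}{z},\,-\mathrm{i}\big(z+\tfrac{t^2-1}{z}\big),\,2\ln z,\,\tfrac{2t}{z}\Big)\Big].$$ When $\lambda$ is real, $\mathbf{x}$ is single-valued on $M=\mathbb{C}\setminus\{0\}$ and the surface is the map $\mathbf{x}:\mathbb{C}\setminus\{0\}\to\mathbb{R}^4_1$. When $\lambda$ is not real, the period condition fails on $\mathbb{C}\setminus\{0\}$ and the surface is the map defined on the universal covering $\mathbb{C}$, with coordinate $w=\ln z$. "Embedded" means without self-intersection; a self-intersection point corresponds to two distinct points of the domain with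 the same image. The unique end (of the universal covering $\mathbb{C}$) is not embedded means that the restriction of $\mathbf{x}$ to the complement of any compact subset is not injective. *)

theory Defs
  imports "HOL-Complex_Analysis.Complex_Analysis"
begin

section \<open>Spacelike surfaces in Lorentz--Minkowski 4-space\<close>

definition lorentz :: "real^4 \<Rightarrow> real^4 \<Rightarrow> real" where
  "lorentz x y = x$1 * y$1 + x$2 * y$2 + x$3 * y$3 - x$4 * y$4"

text \<open>Surfaces are parametrised by open subsets of the plane, identified with \<^typ>\<open>complex\<close>;
  \<open>dir_deriv v X z\<close> is the derivative at \<open>z\<close> in direction \<open>v\<close>, so the directions
  \<open>1\<close> and \<open>\<i>\<close> give the two coordinate derivatives.\<close>

definition dir_deriv :: "complex \<Rightarrow> (complex \<Rightarrow> real^4) \<Rightarrow> complex \<Rightarrow> real^4" where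
  "dir_deriv v X z = frechet_derivative X (at z) v"

text \<open>Real differentiability of order \<open>k\<close>; only used on open sets.\<close>

primrec cont_diff_on :: "nat \<Rightarrow> complex set \<Rightarrow> (complex \<Rightarrow> real^4) \<Rightarrow> bool" where
  "cont_diff_on 0 S X \<longleftrightarrow> continuous_on S X"
| "cont_diff_on (Suc k) S X \<longleftrightarrow>
     (\<forall>z\<in>S. X differentiable at z) \<and> (\<forall>v. cont_diff_on k S (dir_deriv v X))"

definition smooth_on :: "complex set \<Rightarrow> (complex \<Rightarrow> real^4) \<Rightarrow> bool" where
  "smooth_on S X \<longleftrightarrow> (\<forall>k. cont_diff_on k S X)"

text \<open>The induced metric is positive definite. This forces the differential to be injective,
  so \<open>X\<close> is in particular an immersion.\<close>

definition spacelike_immersion_on :: "complex set \<Rightarrow> (complex \<Rightarrow> real^4) \<Rightarrow> bool" where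
  "spacelike_immersion_on S X \<longleftrightarrow> smooth_on S X \<and>
     (\<forall>z\<in>S. \<forall>v. v \<noteq> 0 \<longrightarrow> lorentz (dir_deriv v X z) (dir_deriv v X z) > 0)"

text \<open>Component of \<open>V\<close> that is Lorentz-orthogonal to the spacelike plane spanned by \<open>a\<close> and \<open>b\<close>.\<close>

definition normal_part :: "real^4 \<Rightarrow> real^4 \<Rightarrow> real^4 \<Rightarrow> real^4" where
  "normal_part a b V =
     (let E = lorentz a a; F = lorentz a b; G = lorentz b b;
          p = lorentz V a; q = lorentz V b
      in V - ((G * p - F * q) / (E * G - F\<^sup>2)) *\<^sub>R a - ((E * q - F * p) / (E * G - F\<^sup>2)) *\<^sub>R b)"

text \<open>Half the trace, with respect to the induced metric, of the second fundamental form
  (the normal part of the second derivatives).\<close>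

definition mean_curvature_vector :: "(complex \<Rightarrow> real^4) \<Rightarrow> complex \<Rightarrow> real^4" where
  "mean_curvature_vector X z =
     (let a = dir_deriv 1 X z; b = dir_deriv \<i> X z;
          E = lorentz a a; F = lorentz a b; G = lorentz b b;
          N = normal_part a b
      in (1 / (2 * (E * G - F\<^sup>2))) *\<^sub>R
           (G *\<^sub>R N (dir_deriv 1 (dir_deriv 1 X) z)
            - (2 * F) *\<^sub>R N (dir_deriv 1 (dir_deriv \<i> X) z)
            + E *\<^sub>R N (dir_deriv \<i> (dir_deriv \<i> X) z)))"

definition stationary_surface_on :: "complex set \<Rightarrow> (complex \<Rightarrow> real^4) \<Rightarrow> bool" where
  "stationary_surface_on S X \<longleftrightarrow>
     open S \<and> connected S \<and> spacelike_immersion_on S X \<and> (\<forall>z\<in>S. mean_curvature_vector X z = 0)"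

definition has_self_intersection_on :: "complex set \<Rightarrow> (complex \<Rightarrow> real^4) \<Rightarrow> bool" where
  "has_self_intersection_on S X \<longleftrightarrow> (\<exists>p\<in>S. \<exists>q\<in>S. p \<noteq> q \<and> X p = X q)"

definition embedded_on :: "complex set \<Rightarrow> (complex \<Rightarrow> real^4) \<Rightarrow> bool" where
  "embedded_on S X \<longleftrightarrow> \<not> has_self_intersection_on S X"

text \<open>The end of a surface defined on the whole complex plane, whose end is unique.\<close>

definition embedded_end :: "(complex \<Rightarrow> real^4) \<Rightarrow> bool" where
  "embedded_end X \<longleftrightarrow> (\<exists>K. compact K \<and> inj_on X (- K))"


section \<open>Weierstrass representation\<close>

text \<open>The \<open>\<complex>\<^sup>4\<close>-valued form with data \<open>\<phi>\<close>, \<open>\<psi>\<close>, \<open>dh = h dz\<close>. Each component is a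
  meromorphic function; \<^const>\<open>remove_sings\<close> supplies its value at points where a pole of
  \<open>\<phi>\<close> or \<open>\<psi>\<close> is cancelled by a zero of \<open>h\<close>, where the pointwise product would be
  affected by the convention \<open>x / 0 = 0\<close>.\<close>

definition weierstrass_form ::
  "(complex \<Rightarrow> complex) \<Rightarrow> (complex \<Rightarrow> complex) \<Rightarrow> (complex \<Rightarrow> complex) \<Rightarrow> complex \<Rightarrow> complex^4" where
  "weierstrass_form \<phi> \<psi> h z = vector
     [remove_sings (\<lambda>z. (\<phi> z + \<psi> z) * h z) z,
      remove_sings (\<lambda>z. - \<i> * (\<phi> z - \<psi> z) * h z) z,
      remove_sings (\<lambda>z. (1 - \<phi> z * \<psi> z) * h z) z,
      remove_sings (\<lambda>z. (1 + \<phi> z * \<psi> z) * h z) z]"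

text \<open>\<open>X = 2 Re \<integral> \<omega>\<close> on \<open>S\<close>, up to translation. The formula is required for every path in \<open>S\<close>
  from the base point, so the existence of such an \<open>X\<close> includes the period condition on \<open>S\<close>.\<close>

definition given_by_integral ::
  "complex set \<Rightarrow> (complex \<Rightarrow> complex^4) \<Rightarrow> (complex \<Rightarrow> real^4) \<Rightarrow> bool" where
  "given_by_integral S \<omega> X \<longleftrightarrow>
     (\<exists>p\<in>S. \<exists>c. \<forall>\<gamma>. valid_path \<gamma> \<and> path_image \<gamma> \<subseteq> S \<and> pathstart \<gamma> = p \<longrightarrow>
        X (pathfinish \<gamma>) = c + (\<chi> j. 2 * Re (contour_integral \<gamma> (\<lambda>z. \<omega> z $ j))))"

definition catenoid_form :: "real \<Rightarrow> complex \<Rightarrow> complex \<Rightarrow> complex^4" where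
  "catenoid_form t lam = weierstrass_form
     (\<lambda>z. z + of_real t) (\<lambda>z. - 1 / (z - of_real t)) (\<lambda>z. lam * (z - of_real t) / z\<^sup>2)"

definition surface_on_punctured_plane :: "real \<Rightarrow> complex \<Rightarrow> (complex \<Rightarrow> real^4) \<Rightarrow> bool" where
  "surface_on_punctured_plane t lam X \<longleftrightarrow> given_by_integral (- {0}) (catenoid_form t lam) X"

text \<open>The universal covering of the punctured plane is \<open>exp\<close> on the complex plane
  (see \<open>covering_space_exp_punctured_plane\<close>), so the form is pulled back along \<open>z = exp w\<close>.\<close>

definition surface_on_universal_covering :: "real \<Rightarrow> complex \<Rightarrow> (complex \<Rightarrow> real^4) \<Rightarrow> bool" where
  "surface_on_universal_covering t lam X \<longleftrightarrow>
     given_by_integral UNIV (\<lambda>w. \<chi> j. catenoid_form t lam (exp w) $ j * exp w) X"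

end

theory Submission
  imports Defs
begin

text \<open>Explicitly, up to translation, the surface is
  \<open>2 Re [\<lambda> (z + (t\<^sup>2 + 1) / z, - \<i> (z + (t\<^sup>2 - 1) / z), 2 ln z, 2 t / z)]\<close>.

  Stationarity is a feature of the Weierstrass representation. If the real part of a holomorphic
  \<open>\<complex>\<^sup>4\<close>-valued form \<open>\<omega>\<close> is the differential of \<open>X\<close> and \<open>\<omega>\<close> is null for the complexified Lorentz
  form, then \<open>X\<close> is conformal, so its mean curvature vector is a multiple of the normal part of the
  Laplacian of \<open>X\<close>, and that vanishes because \<open>X\<close> is harmonic. The metric is positive
  because \<open>t\<^sup>2 < 1\<close>: its conformal factor is a positive multiple of
  \<open>(\<bar>z\<bar>\<^sup>2 - t\<^sup>2 + 1)\<^sup>2 + (2 t Im z)\<^sup>2\<close>. This is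
  \<open>stationary_surface_on_null_form\<close> together with \<open>catenoid_density_null\<close> and
  \<open>catenoid_density_spacelike\<close>.

  Embeddedness in the two special cases is read off the coordinates. For real \<open>\<lambda>\<close> the third
  coordinate gives \<open>\<bar>z\<bar>\<close>, after which the first two are positive multiples of \<open>Re z\<close> and \<open>Im z\<close>,
  up to the sign of \<open>\<lambda>\<close>. For imaginary \<open>\<lambda>\<close> the third coordinate gives \<open>Im w\<close>, where \<open>z = exp w\<close>,
  and one of the first two is a nonzero multiple of \<open>exp u - k exp (- u)\<close> with \<open>u = Re w\<close> and
  \<open>k > 0\<close>, which is strictly increasing in \<open>u\<close>.

  For the remaining \<open>\<lambda>\<close>, look for double points of the form \<open>w\<^sub>0 + d\<close>, \<open>w\<^sub>0 - d\<close>. Equality of the third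
  coordinates forces \<open>d\<close> to be a real multiple \<open>s\<close> of \<open>\<i> cnj \<lambda>\<close>. If \<open>exp w\<^sub>0 = \<i> R\<close> with \<open>R\<^sup>2 = 1 - t\<^sup>2\<close>,
  the other three equations all hold as soon as \<open>\<lambda> sinh d\<close> is real
  (\<open>universal_covering_map_symmetric_eq\<close>). As a function of \<open>s\<close>, the imaginary part of
  \<open>\<lambda> sinh d\<close> oscillates between positive and negative values for arbitrarily large \<open>s\<close>
  (\<open>cosh_sin_sinh_cos_unbounded_zeros\<close>), so there are double points outside every compact set.\<close>

no_notation fps_nth (infixl \<open>$\<close> 75)

section \<open>Real parts of holomorphic null forms\<close>

definition twice_Re :: "complex^4 \<Rightarrow> real^4" where
  "twice_Re u = (\<chi> j. 2 * Re (u $ j))"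

text \<open>The extension is bilinear and not Hermitian: it is the vanishing of \<open>\<langle>\<omega>, \<omega>\<rangle>\<close> in this form that
  makes the real part of \<open>\<integral> \<omega>\<close> conformal.\<close>
definition complex_lorentz :: "complex^4 \<Rightarrow> complex^4 \<Rightarrow> complex" where
  "complex_lorentz u v = u$1 * v$1 + u$2 * v$2 + u$3 * v$3 - u$4 * v$4"

text \<open>For a null vector \<open>u\<close>, half of the conformal factor of \<open>v \<mapsto> 2 Re (v u)\<close>; see
  \<open>lorentz_twice_Re\<close> below.\<close>
definition lorentz_hermitian :: "complex^4 \<Rightarrow> real" where
  "lorentz_hermitian u = (cmod (u$1))\<^sup>2 + (cmod (u$2))\<^sup>2 + (cmod (u$3))\<^sup>2 - (cmod (u$4))\<^sup>2"

lemma twice_Re_nth [simp]: "twice_Re u $ j = 2 * Re (u $ j)"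
  by (simp add: twice_Re_def)

text \<open>The real and imaginary parts of a null vector have equal Lorentz norms and are orthogonal, so
  the real part of multiplication by it is conformal. Taking \<open>a\<close> and \<open>b\<close> among \<open>1\<close> and \<open>\<i>\<close> gives the
  coefficients of the first fundamental form.\<close>
lemma lorentz_twice_Re:
  assumes "complex_lorentz u u = 0"
  shows "lorentz (twice_Re (a *s u)) (twice_Re (b *s u)) = 2 * Re (a * cnj b) * lorentz_hermitian u"
proof -
  define A where "A = (Re (u$1))\<^sup>2 + (Re (u$2))\<^sup>2 + (Re (u$3))\<^sup>2 - (Re (u$4))\<^sup>2"
  define B where "B = (Im (u$1))\<^sup>2 + (Im (u$2))\<^sup>2 + (Im (u$3))\<^sup>2 - (Im (u$4))\<^sup>2"
  define C where "C = Re (u$1) * Im (u$1) + Re (u$2) * Im (u$2) + Re (u$3) * Im (u$3) - Re (u$4) * Im (u$4)"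
  have "A - B = Re (complex_lorentz u u)" "2 * C = Im (complex_lorentz u u)"
    by (simp_all add: A_def B_def C_def complex_lorentz_def power2_eq_square algebra_simps)
  then have "A = B" "C = 0"
    using assms by auto
  have "lorentz (twice_Re (a *s u)) (twice_Re (b *s u)) =
      4 * (Re a * Re b * A + Im a * Im b * B - (Re a * Im b + Im a * Re b) * C)"
    by (simp add: lorentz_def A_def B_def C_def power2_eq_square algebra_simps)
  also have "\<dots> = 2 * Re (a * cnj b) * (A + B)"
    by (simp add: \<open>A = B\<close> \<open>C = 0\<close> algebra_simps)
  also have "A + B = lorentz_hermitian u"
    by (simp add: lorentz_hermitian_def A_def B_def cmod_power2)
  finally show ?thesis .
qed

lemma has_derivative_vec:
  fixes X :: "complex \<Rightarrow> real^4"
  assumes "\<And>j. ((\<lambda>z. X z $ j) has_derivative (\<lambda>v. D v $ j)) (at z)"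
  shows "(X has_derivative D) (at z)"
  using assms by (subst has_derivative_componentwise_within) (auto simp: Basis_vec_def inner_axis)

lemma has_derivative_twice_Re_field:
  assumes "(f has_field_derivative d) (at z)"
  shows "((\<lambda>z. 2 * Re (f z)) has_derivative (\<lambda>v. 2 * Re (v * d))) (at z)"
proof -
  have "(f has_derivative (\<lambda>v. d * v)) (at z)"
    using assms by (simp add: has_field_derivative_def)
  from has_derivative_mult_right[OF has_derivative_Re[OF this], of 2]
  show ?thesis by (simp add: mult.commute)
qed

lemma has_derivative_twice_Re:
  assumes "\<And>j. ((\<lambda>z. F z $ j) has_field_derivative D $ j) (at z)"
  shows "((\<lambda>z. twice_Re (F z)) has_derivative (\<lambda>v. twice_Re (v *s D))) (at z)"
  using has_derivative_twice_Re_field[OF assms]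
  by (intro has_derivative_vec) (simp only: twice_Re_nth vector_smult_component)

lemma dir_deriv_eqI:
  assumes "(X has_derivative D) (at z)"
  shows "dir_deriv v X z = D v"
  unfolding dir_deriv_def using frechet_derivative_at[OF assms] by metis

text \<open>The factor \<open>a\<close> records directions already differentiated in, so that the formula can be
  iterated: each further derivative multiplies \<open>a\<close> by a direction and differentiates \<open>u\<close>.\<close>
lemma dir_deriv_twice_Re:
  assumes "open S" "z \<in> S"
    and "\<And>z. z \<in> S \<Longrightarrow> X z = twice_Re (a *s u z)"
    and "\<And>j. ((\<lambda>z. u z $ j) has_field_derivative u' $ j) (at z)"
  shows "X differentiable at z" "dir_deriv v X z = twice_Re ((v * a) *s u')"
proof -
  have "((\<lambda>z. twice_Re (a *s u z)) has_derivative (\<lambda>v. twice_Re (v *s (a *s u')))) (at z)"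
    by (rule has_derivative_twice_Re) (auto intro!: DERIV_cmult assms)
  then have X: "(X has_derivative (\<lambda>v. twice_Re (v *s (a *s u')))) (at z)"
    by (rule has_derivative_transform_within_open[OF _ assms(1,2)]) (use assms(3) in auto)
  then show "X differentiable at z"
    by (auto simp: differentiable_def)
  show "dir_deriv v X z = twice_Re ((v * a) *s u')"
    using dir_deriv_eqI[OF X, of v] by (simp add: vector_smult_assoc)
qed

lemma cont_diff_on_twice_Re:
  assumes "open S"
    and "\<And>z. z \<in> S \<Longrightarrow> X z = twice_Re (a *s u z)"
    and "\<And>j. (\<lambda>z. u z $ j) holomorphic_on S"
  shows "cont_diff_on k S X"
  using assms(2,3)
proof (induction k arbitrary: X a u)
  case 0
  have "continuous_on S (\<lambda>z. twice_Re (a *s u z))"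
    unfolding twice_Re_def vector_smult_component
    by (intro continuous_on_vec_lambda continuous_on_mult_left continuous_on_Re
        holomorphic_on_imp_continuous_on[OF 0(2)])
  then show ?case
    using 0 by (simp cong: continuous_on_cong)
next
  case (Suc k)
  let ?u' = "\<lambda>z. \<chi> j. deriv (\<lambda>z. u z $ j) z"
  have D: "((\<lambda>z. u z $ j) has_field_derivative ?u' z $ j) (at z)" if "z \<in> S" for z j
    using holomorphic_derivI[OF Suc.prems(2) assms(1) that] by simp
  have "cont_diff_on k S (dir_deriv v X)" for v
  proof (rule Suc.IH)
    show "dir_deriv v X z = twice_Re ((v * a) *s ?u' z)" if "z \<in> S" for z
      by (rule dir_deriv_twice_Re[OF assms(1) that Suc.prems(1) D[OF that]])
    show "(\<lambda>z. ?u' z $ j) holomorphic_on S" for j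
      using holomorphic_deriv[OF Suc.prems(2) assms(1)] by simp
  qed
  moreover have "X differentiable at z" if "z \<in> S" for z
    by (rule dir_deriv_twice_Re[OF assms(1) that Suc.prems(1) D[OF that]])
  ultimately show ?case by simp
qed

text \<open>The hypothesis on \<open>X\<close> concerns its differential only, so it also covers surfaces such as the
  catenoid, where \<open>X\<close> is single-valued although \<open>\<omega>\<close> has no holomorphic primitive. The mean curvature
  vanishes because the coordinates are isothermal and \<open>\<i>\<^sup>2 = - 1\<close> turns the second
  \<open>\<i>\<close>-derivative into the negative of the second \<open>1\<close>-derivative.\<close>
lemma stationary_surface_on_null_form:
  assumes "open S" "connected S"
    and hol: "\<And>j. (\<lambda>z. \<omega> z $ j) holomorphic_on S"
    and null: "\<And>z. z \<in> S \<Longrightarrow> complex_lorentz (\<omega> z) (\<omega> z) = 0"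
    and pos: "\<And>z. z \<in> S \<Longrightarrow> lorentz_hermitian (\<omega> z) > 0"
    and X: "\<And>z. z \<in> S \<Longrightarrow> (X has_derivative (\<lambda>v. twice_Re (v *s \<omega> z))) (at z)"
  shows "stationary_surface_on S X"
proof -
  have D1: "dir_deriv v X z = twice_Re (v *s \<omega> z)" if "z \<in> S" for v z
    by (rule dir_deriv_eqI[OF X[OF that]])
  have "cont_diff_on k S X" for k
  proof (cases k)
    case 0
    then show ?thesis
      using has_derivative_continuous[OF X] by (simp add: continuous_at_imp_continuous_on)
  next
    case (Suc l)
    then show ?thesis
      using differentiableI[OF X] cont_diff_on_twice_Re[OF assms(1) D1 hol] by simp
  qed
  moreover have "lorentz (dir_deriv v X z) (dir_deriv v X z) > 0" if "z \<in> S" "v \<noteq> 0" for v z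
  proof -
    have "Re (v * cnj v) > 0"
      using that(2) by (simp add: complex_mult_cnj complex_neq_0)
    then show ?thesis
      using pos[OF that(1)] by (simp add: D1 that null lorentz_twice_Re)
  qed
  moreover have "mean_curvature_vector X z = 0" if z: "z \<in> S" for z
  proof -
    let ?\<omega>' = "\<chi> j. deriv (\<lambda>z. \<omega> z $ j) z"
    have \<omega>': "((\<lambda>z. \<omega> z $ j) has_field_derivative ?\<omega>' $ j) (at z)" for j
      using holomorphic_derivI[OF hol assms(1) z] by simp
    have D2: "dir_deriv v (dir_deriv a X) z = twice_Re ((v * a) *s ?\<omega>')" for v a
      by (rule dir_deriv_twice_Re(2)[OF assms(1) z _ \<omega>']) (rule D1)
    have harm: "dir_deriv \<i> (dir_deriv \<i> X) z = - dir_deriv 1 (dir_deriv 1 X) z"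
      by (simp add: D2 vec_eq_iff)
    define a b where "a = dir_deriv 1 X z" and "b = dir_deriv \<i> X z"
    have "lorentz a b = 0" "lorentz a a = lorentz b b"
      unfolding a_def b_def D1[OF z] lorentz_twice_Re[OF null[OF z]] by simp_all
    moreover have "normal_part a b (- V) = - normal_part a b V" for V
    proof -
      have neg: "lorentz (- V) x = - lorentz V x" for x
        by (simp add: lorentz_def)
      show ?thesis
        unfolding normal_part_def Let_def neg
        by (simp add: algebra_simps diff_divide_distrib scaleR_left_diff_distrib scaleR_left_distrib)
    qed
    ultimately show ?thesis
      unfolding mean_curvature_vector_def Let_def harm a_def[symmetric] b_def[symmetric]
      by simp
  qed
  ultimately show ?thesis
    using assms(1,2)
    by (auto simp: stationary_surface_on_def spacelike_immersion_on_def smooth_on_def)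
qed

text \<open>The fundamental theorem of calculus along the path, applied to a real-valued primitive of the
  real part. A holomorphic primitive of \<open>f\<close> would be too much to ask: on the punctured plane
  \<open>1 / z\<close> has none, while the real part of \<open>dz / z\<close> is the differential of \<open>ln \<bar>z\<bar>\<close>.\<close>
lemma Re_contour_integral_primitive:
  fixes \<phi> :: "complex \<Rightarrow> real"
  assumes "open S" "f holomorphic_on S"
    and \<phi>: "\<And>z. z \<in> S \<Longrightarrow> (\<phi> has_derivative (\<lambda>v. 2 * Re (v * f z))) (at z)"
    and \<gamma>: "valid_path \<gamma>" "path_image \<gamma> \<subseteq> S"
  shows "2 * Re (contour_integral \<gamma> f) = \<phi> (pathfinish \<gamma>) - \<phi> (pathstart \<gamma>)"
proof -
  let ?D = "\<lambda>x. 2 * Re (f (\<gamma> x) * vector_derivative \<gamma> (at x))"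
  have "f contour_integrable_on \<gamma>"
    by (rule contour_integrable_holomorphic_simple[OF assms(2,1) \<gamma>])
  then have "((\<lambda>x. f (\<gamma> x) * vector_derivative \<gamma> (at x)) has_integral contour_integral \<gamma> f) {0..1}"
    using has_contour_integral_integral has_contour_integral by blast
  from has_integral_linear[OF this bounded_linear_Re]
  have "((\<lambda>x. Re (f (\<gamma> x) * vector_derivative \<gamma> (at x))) has_integral Re (contour_integral \<gamma> f)) {0..1}"
    by (simp add: comp_def)
  from has_integral_mult_right[OF this, of 2]
  have "(?D has_integral 2 * Re (contour_integral \<gamma> f)) {0..1}" .
  moreover have "(?D has_integral ((\<phi> \<circ> \<gamma>) 1 - (\<phi> \<circ> \<gamma>) 0)) {0..1}"
  proof -
    obtain T where T: "finite T" "\<gamma> C1_differentiable_on {0..1} - T" and cont: "continuous_on {0..1} \<gamma>"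
      using \<gamma>(1) by (auto simp: valid_path_def piecewise_C1_differentiable_on_def)
    have in_S: "\<gamma> x \<in> S" if "x \<in> {0..1}" for x
      using \<gamma>(2) that by (auto simp: path_image_def)
    have "continuous_on S \<phi>"
      using has_derivative_continuous[OF \<phi>] by (simp add: continuous_at_imp_continuous_on)
    then have "continuous_on {0..1} (\<phi> \<circ> \<gamma>)"
      using cont in_S by (intro continuous_on_compose) (auto intro: continuous_on_subset)
    moreover have "(\<phi> \<circ> \<gamma> has_vector_derivative ?D x) (at x)" if "x \<in> {0<..<1} - T" for x
    proof -
      have x: "x \<in> {0..1} - T"
        using that by auto
      have "\<gamma> differentiable at x"
        using T(2) x by (auto simp: C1_differentiable_on_eq)
      then have "(\<gamma> has_derivative (\<lambda>h. h *\<^sub>R vector_derivative \<gamma> (at x))) (at x)"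
        using vector_derivative_works by (auto simp: has_vector_derivative_def)
      from diff_chain_at[OF this \<phi>] x in_S
      have "(\<phi> \<circ> \<gamma> has_derivative (\<lambda>v. 2 * Re (v * f (\<gamma> x))) \<circ> (\<lambda>h. h *\<^sub>R vector_derivative \<gamma> (at x))) (at x)"
        by blast
      moreover have "(\<lambda>v. 2 * Re (v * f (\<gamma> x))) \<circ> (\<lambda>h. h *\<^sub>R vector_derivative \<gamma> (at x)) = (\<lambda>h. h *\<^sub>R ?D x)"
        by (auto simp: algebra_simps)
      ultimately show ?thesis
        by (simp only: has_vector_derivative_def)
    qed
    ultimately show ?thesis
      by (intro fundamental_theorem_of_calculus_interior_strong[OF T(1) zero_le_one])
  qed
  ultimately show ?thesis
    by (auto simp: pathfinish_def pathstart_def dest: has_integral_unique)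
qed

text \<open>Any potential of \<open>2 Re \<omega>\<close> settles both the existence of the surface (the period condition) and
  its uniqueness up to translation.\<close>
lemma given_by_integral_iff:
  assumes "open S" "connected S" "S \<noteq> {}"
    and hol: "\<And>j. (\<lambda>z. \<omega> z $ j) holomorphic_on S"
    and \<Phi>: "\<And>z. z \<in> S \<Longrightarrow> (\<Phi> has_derivative (\<lambda>v. twice_Re (v *s \<omega> z))) (at z)"
  shows "given_by_integral S \<omega> X \<longleftrightarrow> (\<exists>c. \<forall>z\<in>S. X z = c + \<Phi> z)"
proof
  have int: "2 * Re (contour_integral \<gamma> (\<lambda>z. \<omega> z $ j)) = \<Phi> (pathfinish \<gamma>) $ j - \<Phi> (pathstart \<gamma>) $ j"
    if "valid_path \<gamma>" "path_image \<gamma> \<subseteq> S" for \<gamma> j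
  proof (rule Re_contour_integral_primitive[OF assms(1) hol _ that])
    show "((\<lambda>z. \<Phi> z $ j) has_derivative (\<lambda>v. 2 * Re (v * \<omega> z $ j))) (at z)" if "z \<in> S" for z
      using bounded_linear.has_derivative[OF bounded_linear_vec_nth \<Phi>[OF that], of j]
      by (simp only: twice_Re_nth vector_smult_component)
  qed
  show "\<exists>c. \<forall>z\<in>S. X z = c + \<Phi> z" if X: "given_by_integral S \<omega> X"
  proof -
    obtain p c where p: "p \<in> S" and c: "\<And>\<gamma>. valid_path \<gamma> \<Longrightarrow> path_image \<gamma> \<subseteq> S \<Longrightarrow> pathstart \<gamma> = p \<Longrightarrow>
        X (pathfinish \<gamma>) = c + (\<chi> j. 2 * Re (contour_integral \<gamma> (\<lambda>z. \<omega> z $ j)))"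
      using X by (auto simp: given_by_integral_def)
    have "X z = (c - \<Phi> p) + \<Phi> z" if z: "z \<in> S" for z
    proof -
      obtain \<gamma> where "polynomial_function \<gamma>" and \<gamma>: "path_image \<gamma> \<subseteq> S" "pathstart \<gamma> = p" "pathfinish \<gamma> = z"
        using connected_open_polynomial_connected[OF assms(1,2) p z] by blast
      then have "valid_path \<gamma>"
        by (simp add: valid_path_polynomial_function)
      with c[of \<gamma>] int[of \<gamma>] \<gamma> show ?thesis
        by (simp add: vec_eq_iff)
    qed
    then show ?thesis by blast
  qed
  show "given_by_integral S \<omega> X" if X: "\<exists>c. \<forall>z\<in>S. X z = c + \<Phi> z"
  proof -
    obtain c where c: "\<And>z. z \<in> S \<Longrightarrow> X z = c + \<Phi> z"
      using X by blast
    obtain p where p: "p \<in> S"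
      using assms(3) by blast
    have "X (pathfinish \<gamma>) = X p + (\<chi> j. 2 * Re (contour_integral \<gamma> (\<lambda>z. \<omega> z $ j)))"
      if "valid_path \<gamma>" "path_image \<gamma> \<subseteq> S" "pathstart \<gamma> = p" for \<gamma>
    proof -
      have "pathfinish \<gamma> \<in> S"
        using that(2) by auto
      then show ?thesis
        using int[OF that(1,2)] that(3) p by (simp add: c vec_eq_iff)
    qed
    with p show ?thesis
      unfolding given_by_integral_def by blast
  qed
qed

lemma stationary_surface_on_translate_null_form:
  assumes "open S" "connected S"
    and "\<And>j. (\<lambda>z. \<omega> z $ j) holomorphic_on S"
    and "\<And>z. z \<in> S \<Longrightarrow> complex_lorentz (\<omega> z) (\<omega> z) = 0"
    and "\<And>z. z \<in> S \<Longrightarrow> lorentz_hermitian (\<omega> z) > 0"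
    and \<Phi>: "\<And>z. z \<in> S \<Longrightarrow> (\<Phi> has_derivative (\<lambda>v. twice_Re (v *s \<omega> z))) (at z)"
    and X: "\<And>z. z \<in> S \<Longrightarrow> X z = c + \<Phi> z"
  shows "stationary_surface_on S X"
proof (rule stationary_surface_on_null_form)
  fix z assume "z \<in> S"
  have "((\<lambda>z. c + \<Phi> z) has_derivative (\<lambda>v. twice_Re (v *s \<omega> z))) (at z)"
    using has_derivative_add[OF has_derivative_const \<Phi>[OF \<open>z \<in> S\<close>], of c] by simp
  then show "(X has_derivative (\<lambda>v. twice_Re (v *s \<omega> z))) (at z)"
    by (rule has_derivative_transform_within_open[OF _ assms(1) \<open>z \<in> S\<close>]) (simp add: X)
qed (use assms in auto)

section \<open>The Weierstrass form of the family\<close>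

lemma vector_4 [simp]:
  fixes x y z w :: "'a::zero"
  shows "(vector [x, y, z, w] :: 'a^4) $ 1 = x"
    and "(vector [x, y, z, w] :: 'a^4) $ 2 = y"
    and "(vector [x, y, z, w] :: 'a^4) $ 3 = z"
    and "(vector [x, y, z, w] :: 'a^4) $ 4 = w"
  unfolding vector_def by simp_all

text \<open>The four components of the form with the cancellable factor \<open>z - t\<close> divided out; the common
  factor \<open>\<lambda> / z\<^sup>2\<close> is pulled out because nullity and the sign of the metric do not depend on it.\<close>
definition catenoid_density :: "real \<Rightarrow> complex \<Rightarrow> complex \<Rightarrow> complex^4" where
  "catenoid_density t lam z =
     (lam / z\<^sup>2) *s vector [z\<^sup>2 - (of_real t)\<^sup>2 - 1, - \<i> * (z\<^sup>2 - (of_real t)\<^sup>2 + 1), 2 * z, - 2 * of_real t]"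

text \<open>The logarithm \<open>l\<close> of \<open>z\<close> is a separate argument: on the universal covering it is the coordinate
  \<open>w\<close> itself, on the punctured plane only its real part \<open>ln \<bar>z\<bar>\<close> is single-valued.\<close>
definition catenoid_primitive :: "real \<Rightarrow> complex \<Rightarrow> complex \<Rightarrow> complex \<Rightarrow> complex^4" where
  "catenoid_primitive t lam z l =
     lam *s vector [z + ((of_real t)\<^sup>2 + 1) / z, - \<i> * (z + ((of_real t)\<^sup>2 - 1) / z), 2 * l, 2 * of_real t / z]"

lemma remove_sings_eq_continuous:
  assumes "isCont g z" "eventually (\<lambda>w. f w = g w) (at z)"
  shows "remove_sings f z = g z"
proof (rule remove_sings_eqI)
  show "f \<midarrow>z\<rightarrow> g z"
    using assms by (metis isCont_def tendsto_cong)
qed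

text \<open>At \<open>z = t\<close> the pole of \<open>\<psi>\<close> meets the zero of \<open>dh\<close>; away from \<open>t\<close> and \<open>0\<close> the two sides agree
  literally, and the right-hand side is continuous at \<open>z\<close>.\<close>
lemma catenoid_form_eq_density:
  assumes "z \<noteq> 0"
  shows "catenoid_form t lam z = catenoid_density t lam z"
proof -
  let ?P = "\<lambda>w. w \<noteq> of_real t \<and> w \<noteq> (0::complex)"
  have ev: "eventually ?P (at z)"
    by (intro eventually_conj eventually_neq_at_within)
  have rs: "remove_sings f z = g z" if "isCont g z" "\<And>w. ?P w \<Longrightarrow> f w = g w" for f g
    by (rule remove_sings_eq_continuous[OF that(1) eventually_mono[OF ev that(2)]])
  have "remove_sings (\<lambda>w. (w + of_real t + - 1 / (w - of_real t)) * (lam * (w - of_real t) / w\<^sup>2)) z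
      = lam / z\<^sup>2 * (z\<^sup>2 - (of_real t)\<^sup>2 - 1)"
    using assms by (intro rs) (auto intro!: continuous_intros simp: divide_simps, simp add: power2_eq_square algebra_simps)
  moreover have "remove_sings (\<lambda>w. - \<i> * (w + of_real t - - 1 / (w - of_real t)) * (lam * (w - of_real t) / w\<^sup>2)) z
      = lam / z\<^sup>2 * (- \<i> * (z\<^sup>2 - (of_real t)\<^sup>2 + 1))"
    using assms by (intro rs) (auto intro!: continuous_intros simp: divide_simps, simp add: power2_eq_square algebra_simps)
  moreover have "remove_sings (\<lambda>w. (1 - (w + of_real t) * (- 1 / (w - of_real t))) * (lam * (w - of_real t) / w\<^sup>2)) z
      = lam / z\<^sup>2 * (2 * z)"
    using assms by (intro rs) (auto intro!: continuous_intros simp: divide_simps)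
  moreover have "remove_sings (\<lambda>w. (1 + (w + of_real t) * (- 1 / (w - of_real t))) * (lam * (w - of_real t) / w\<^sup>2)) z
      = lam / z\<^sup>2 * (- 2 * of_real t)"
    using assms by (intro rs) (auto intro!: continuous_intros simp: divide_simps)
  ultimately show ?thesis
    by (simp add: catenoid_form_def weierstrass_form_def catenoid_density_def vec_eq_iff forall_4)
qed

lemma complex_lorentz_smult:
  "complex_lorentz (c *s u) (c *s u) = c\<^sup>2 * complex_lorentz u u"
  by (simp add: complex_lorentz_def power2_eq_square algebra_simps)

lemma lorentz_hermitian_smult:
  "lorentz_hermitian (c *s u) = (cmod c)\<^sup>2 * lorentz_hermitian u"
  by (simp add: lorentz_hermitian_def norm_mult power_mult_distrib algebra_simps)

lemma catenoid_density_null: "complex_lorentz (catenoid_density t lam z) (catenoid_density t lam z) = 0"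
  unfolding catenoid_density_def complex_lorentz_smult
  by (simp add: complex_lorentz_def power2_eq_square algebra_simps)

lemma catenoid_density_spacelike:
  assumes "- 1 < t" "t < 1" "lam \<noteq> 0" "z \<noteq> 0"
  shows "lorentz_hermitian (catenoid_density t lam z) > 0"
proof -
  let ?u = "vector [z\<^sup>2 - (of_real t)\<^sup>2 - 1, - \<i> * (z\<^sup>2 - (of_real t)\<^sup>2 + 1), 2 * z, - 2 * of_real t] :: complex^4"
  \<comment> \<open>The right-hand side is twice the squared modulus of \<open>(z + t) (cnj z - t) + 1\<close>, which vanishes
    exactly where \<open>\<phi>\<close> is the conjugate of \<open>\<psi>\<close>.\<close>
  have "lorentz_hermitian ?u = 2 * (((cmod z)\<^sup>2 - t\<^sup>2 + 1)\<^sup>2 + (2 * t * Im z)\<^sup>2)"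
    unfolding lorentz_hermitian_def cmod_power2
    by (simp add: power2_eq_square algebra_simps)
  moreover have "t\<^sup>2 < 1"
    using assms by (simp add: abs_square_less_1)
  then have "0 < (cmod z)\<^sup>2 - t\<^sup>2 + 1"
    by (smt (verit) zero_le_power2)
  ultimately have "lorentz_hermitian ?u > 0"
    by (smt (verit) zero_le_power2 zero_less_power2)
  then show ?thesis
    using assms by (simp add: catenoid_density_def lorentz_hermitian_smult)
qed

lemma catenoid_density_holomorphic: "(\<lambda>z. catenoid_density t lam z $ j) holomorphic_on - {0}"
proof -
  have "\<forall>j. (\<lambda>z. catenoid_density t lam z $ j) holomorphic_on - {0}"
    unfolding forall_4 catenoid_density_def by (auto intro!: holomorphic_intros)
  then show ?thesis ..
qed

lemma catenoid_primitive_chain: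
  assumes "(f has_field_derivative f') (at w within S)" "f w \<noteq> 0"
    and "(l has_field_derivative f' / f w) (at w within S)"
  shows "((\<lambda>w. catenoid_primitive t lam (f w) (l w) $ j) has_field_derivative
           catenoid_density t lam (f w) $ j * f') (at w within S)"
proof -
  have "\<forall>j. ((\<lambda>w. catenoid_primitive t lam (f w) (l w) $ j) has_field_derivative
           catenoid_density t lam (f w) $ j * f') (at w within S)"
    unfolding forall_4 catenoid_density_def catenoid_primitive_def using assms(2)
    by (auto intro!: derivative_eq_intros assms(1,3) simp: field_simps power2_eq_square)
  then show ?thesis ..
qed

section \<open>Explicit parametrisations\<close>

text \<open>For real \<open>\<lambda>\<close> the argument of \<open>z\<close> drops out of the third coordinate: this is the period
  condition.\<close>
lemma twice_Re_primitive_cong: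
  assumes "lam \<in> \<real>" "Re l = Re l'"
  shows "twice_Re (catenoid_primitive t lam z l) = twice_Re (catenoid_primitive t lam z l')"
  using assms by (auto simp: catenoid_primitive_def vec_eq_iff forall_4 complex_is_Real_iff)

lemma open_punctured_plane: "open (- {0 :: complex})"
  by (intro open_Compl closed_singleton)

lemma connected_punctured_plane: "connected (- {0 :: complex})"
  by (intro connected_punctured_universe) simp

definition punctured_plane_map :: "real \<Rightarrow> complex \<Rightarrow> complex \<Rightarrow> real^4" where
  "punctured_plane_map t lam z = twice_Re (catenoid_primitive t lam z (of_real (ln (cmod z))))"

definition universal_covering_map :: "real \<Rightarrow> complex \<Rightarrow> complex \<Rightarrow> real^4" where
  "universal_covering_map t lam w = twice_Re (catenoid_primitive t lam (exp w) w)"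

lemma has_derivative_punctured_plane_map:
  assumes "lam \<in> \<real>" "z \<noteq> 0"
  shows "(punctured_plane_map t lam has_derivative
           (\<lambda>v. twice_Re (v *s catenoid_form t lam z))) (at z)"
proof -
  \<comment> \<open>A branch of the logarithm that is holomorphic near \<open>z\<close>, including on the negative real axis;
    its real part is \<open>ln \<bar>w\<bar>\<close> everywhere.\<close>
  let ?l = "\<lambda>w. Ln (w / z) + of_real (ln (cmod z))"
  have deriv: "((\<lambda>w. twice_Re (catenoid_primitive t lam w (?l w))) has_derivative
          (\<lambda>v. twice_Re (v *s catenoid_form t lam z))) (at z)"
  proof (rule has_derivative_twice_Re)
    have "(?l has_field_derivative 1 / z) (at z)"
      using assms(2) by (auto intro!: derivative_eq_intros)
    then show "((\<lambda>w. catenoid_primitive t lam w (?l w) $ j) has_field_derivative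
        catenoid_form t lam z $ j) (at z)" for j
      using catenoid_primitive_chain[OF DERIV_ident assms(2), of ?l UNIV t lam j] assms(2)
      by (simp add: catenoid_form_eq_density)
  qed
  have eq: "twice_Re (catenoid_primitive t lam w (?l w)) = punctured_plane_map t lam w"
    if "w \<in> - {0}" for w
    unfolding punctured_plane_map_def using that assms
    by (intro twice_Re_primitive_cong) (auto simp: norm_divide ln_div)
  show ?thesis
    by (rule has_derivative_transform_within_open[OF deriv open_punctured_plane _ eq])
       (use assms(2) in auto)
qed

definition covering_form :: "real \<Rightarrow> complex \<Rightarrow> complex \<Rightarrow> complex^4" where
  "covering_form t lam w = exp w *s catenoid_density t lam (exp w)"

lemma surface_on_universal_covering_eq:
  "surface_on_universal_covering t lam X = given_by_integral UNIV (covering_form t lam) X"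
proof -
  have "(\<lambda>w. \<chi> j. catenoid_form t lam (exp w) $ j * exp w) = covering_form t lam"
    by (auto simp: fun_eq_iff vec_eq_iff covering_form_def catenoid_form_eq_density)
  then show ?thesis
    by (simp add: surface_on_universal_covering_def)
qed

lemma has_derivative_universal_covering_map:
  "(universal_covering_map t lam has_derivative (\<lambda>v. twice_Re (v *s covering_form t lam w))) (at w)"
  unfolding universal_covering_map_def
proof (rule has_derivative_twice_Re)
  show "((\<lambda>w. catenoid_primitive t lam (exp w) w $ j) has_field_derivative
      covering_form t lam w $ j) (at w)" for j
    using catenoid_primitive_chain[OF DERIV_exp exp_not_eq_zero, of "\<lambda>w. w" w t lam j]
    by (simp add: covering_form_def mult.commute)
qed

lemma catenoid_form_holomorphic: "(\<lambda>z. catenoid_form t lam z $ j) holomorphic_on - {0}"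
  using catenoid_density_holomorphic
  by (rule holomorphic_transform) (simp add: catenoid_form_eq_density)

lemma covering_form_holomorphic: "(\<lambda>w. covering_form t lam w $ j) holomorphic_on UNIV"
proof -
  have "range exp \<subseteq> - {0 :: complex}"
    by auto
  from holomorphic_on_compose_gen[OF holomorphic_on_exp catenoid_density_holomorphic this]
  show ?thesis
    unfolding covering_form_def vector_smult_component
    by (intro holomorphic_intros) (simp add: comp_def)
qed

lemma surface_on_punctured_plane_iff:
  assumes "lam \<in> \<real>"
  shows "surface_on_punctured_plane t lam X \<longleftrightarrow>
           (\<exists>c. \<forall>z\<in>- {0}. X z = c + punctured_plane_map t lam z)"
  unfolding surface_on_punctured_plane_def
proof (rule given_by_integral_iff)
  show "- {0} \<noteq> ({} :: complex set)"
    by (metis ComplI empty_iff singletonD zero_neq_one)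
qed (use assms in \<open>auto intro: open_punctured_plane connected_punctured_plane catenoid_form_holomorphic
       has_derivative_punctured_plane_map\<close>)

lemma surface_on_universal_covering_iff:
  "surface_on_universal_covering t lam X \<longleftrightarrow> (\<exists>c. \<forall>w. X w = c + universal_covering_map t lam w)"
  unfolding surface_on_universal_covering_eq
  using given_by_integral_iff[OF open_UNIV connected_UNIV UNIV_not_empty covering_form_holomorphic
      has_derivative_universal_covering_map]
  by simp

lemma stationary_surface_on_punctured_plane:
  assumes "- 1 < t" "t < 1" "lam \<noteq> 0" "lam \<in> \<real>"
    and "\<And>z. z \<noteq> 0 \<Longrightarrow> X z = c + punctured_plane_map t lam z"
  shows "stationary_surface_on (- {0}) X"
proof (rule stationary_surface_on_translate_null_form)
  fix z :: complex assume "z \<in> - {0}"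
  then have z: "z \<noteq> 0"
    by simp
  show "complex_lorentz (catenoid_form t lam z) (catenoid_form t lam z) = 0"
    using z by (simp add: catenoid_form_eq_density catenoid_density_null)
  show "lorentz_hermitian (catenoid_form t lam z) > 0"
    using z assms by (simp add: catenoid_form_eq_density catenoid_density_spacelike)
  show "(punctured_plane_map t lam has_derivative (\<lambda>v. twice_Re (v *s catenoid_form t lam z))) (at z)"
    by (rule has_derivative_punctured_plane_map[OF assms(4) z])
qed (use assms(5) in \<open>auto intro: open_punctured_plane connected_punctured_plane catenoid_form_holomorphic\<close>)

lemma stationary_surface_on_universal_covering:
  assumes "- 1 < t" "t < 1" "lam \<noteq> 0"
    and "\<And>w. X w = c + universal_covering_map t lam w"
  shows "stationary_surface_on UNIV X"
proof (rule stationary_surface_on_translate_null_form)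
  show "complex_lorentz (covering_form t lam w) (covering_form t lam w) = 0" for w
    by (simp add: covering_form_def complex_lorentz_smult catenoid_density_null)
  show "lorentz_hermitian (covering_form t lam w) > 0" for w
    using catenoid_density_spacelike[OF assms(1-3), of "exp w"]
    by (simp add: covering_form_def lorentz_hermitian_smult)
qed (use assms(4) in \<open>auto intro: covering_form_holomorphic has_derivative_universal_covering_map\<close>)

section \<open>Embeddedness of catenoids and helicoids\<close>

lemma Re_add_divide_self:
  "Re (z + of_real k / z) = Re z * (1 + k / (cmod z)\<^sup>2)"
  unfolding cmod_power2 by (simp add: Re_divide algebra_simps)

lemma Im_add_divide_self:
  "Im (z + of_real k / z) = Im z * (1 - k / (cmod z)\<^sup>2)"
  unfolding cmod_power2 by (simp add: Im_divide algebra_simps)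

lemma catenoid_primitive_components:
  "twice_Re (catenoid_primitive t lam z l) $ 1 = 2 * Re (lam * (z + of_real (t\<^sup>2 + 1) / z))"
  "twice_Re (catenoid_primitive t lam z l) $ 2 = 2 * Im (lam * (z + of_real (t\<^sup>2 - 1) / z))"
  "twice_Re (catenoid_primitive t lam z l) $ 3 = 4 * Re (lam * l)"
  "twice_Re (catenoid_primitive t lam z l) $ 4 = 4 * t * Re (lam / z)"
proof -
  have "lam * (- \<i> * w) = - \<i> * (lam * w)" for w
    by simp
  then show "twice_Re (catenoid_primitive t lam z l) $ 2 = 2 * Im (lam * (z + of_real (t\<^sup>2 - 1) / z))"
    unfolding catenoid_primitive_def twice_Re_nth vector_smult_component vector_4
    by (simp only:) simp
  have "lam * (2 * of_real t / z) = of_real (2 * t) * (lam / z)"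
    by simp
  moreover have "Re (of_real (2 * t) * w) = 2 * t * Re w" for w
    by simp
  ultimately show "twice_Re (catenoid_primitive t lam z l) $ 4 = 4 * t * Re (lam / z)"
    unfolding catenoid_primitive_def twice_Re_nth vector_smult_component vector_4
    by (simp only:)
qed (simp_all add: catenoid_primitive_def)

text \<open>Each parallel \<open>\<bar>z\<bar> = r\<close> is mapped at constant height \<open>4 \<lambda> ln r\<close>, and the first two
  coordinates trace an ellipse, nondegenerate because \<open>t\<^sup>2 < 1\<close>.\<close>
lemma inj_punctured_plane_map:
  assumes "- 1 < t" "t < 1" "lam \<noteq> 0" "lam \<in> \<real>"
  shows "inj_on (punctured_plane_map t lam) (- {0})"
proof (rule inj_onI)
  fix z z' assume "z \<in> - {0}" "z' \<in> - {0}"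
    and eq: "punctured_plane_map t lam z = punctured_plane_map t lam z'"
  then have nz: "z \<noteq> 0" "z' \<noteq> 0"
    by auto
  obtain a where a: "lam = of_real a" "a \<noteq> 0"
    using assms(3,4) by (auto elim: Reals_cases)
  have comp: "punctured_plane_map t lam z $ 1 = 2 * a * (Re z * (1 + (t\<^sup>2 + 1) / (cmod z)\<^sup>2))"
    "punctured_plane_map t lam z $ 2 = 2 * a * (Im z * (1 + (1 - t\<^sup>2) / (cmod z)\<^sup>2))"
    "punctured_plane_map t lam z $ 3 = 4 * a * ln (cmod z)" for z
  proof -
    have scale: "Re (of_real a * w) = a * Re w" "Im (of_real a * w) = a * Im w" for w
      by simp_all
    have "1 - (t\<^sup>2 - 1) / r = 1 + (1 - t\<^sup>2) / r" for r
      by (simp add: diff_divide_distrib)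
    then show "punctured_plane_map t lam z $ 1 = 2 * a * (Re z * (1 + (t\<^sup>2 + 1) / (cmod z)\<^sup>2))"
      "punctured_plane_map t lam z $ 2 = 2 * a * (Im z * (1 + (1 - t\<^sup>2) / (cmod z)\<^sup>2))"
      "punctured_plane_map t lam z $ 3 = 4 * a * ln (cmod z)"
      unfolding punctured_plane_map_def catenoid_primitive_components a scale
        Re_add_divide_self Im_add_divide_self
      by simp_all
  qed
  have "ln (cmod z) = ln (cmod z')"
    using arg_cong[OF eq, of "\<lambda>x. x $ 3"] a(2) by (simp add: comp)
  then have norm: "cmod z = cmod z'"
    using nz by simp
  have "t\<^sup>2 < 1"
    using assms by (simp add: abs_square_less_1)
  then have "1 + (t\<^sup>2 + 1) / (cmod z')\<^sup>2 > 0" "1 + (1 - t\<^sup>2) / (cmod z')\<^sup>2 > 0"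
    by (auto intro!: add_pos_nonneg divide_nonneg_nonneg)
  moreover have "Re z * (1 + (t\<^sup>2 + 1) / (cmod z')\<^sup>2) = Re z' * (1 + (t\<^sup>2 + 1) / (cmod z')\<^sup>2)"
    using arg_cong[OF eq, of "\<lambda>x. x $ 1"] a(2) by (simp add: comp norm)
  moreover have "Im z * (1 + (1 - t\<^sup>2) / (cmod z')\<^sup>2) = Im z' * (1 + (1 - t\<^sup>2) / (cmod z')\<^sup>2)"
    using arg_cong[OF eq, of "\<lambda>x. x $ 2"] a(2) by (simp add: comp norm)
  ultimately show "z = z'"
    by (simp add: complex_eq_iff)
qed

lemma strict_mono_exp_minus_exp_neg:
  assumes "k > 0"
  shows "strict_mono (\<lambda>u :: real. exp u - k * exp (- u))"
  using assms by (intro strict_monoI diff_strict_mono mult_strict_left_mono) auto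

text \<open>Each curve \<open>Im w = const\<close> lies in a level set of the third coordinate, different curves in
  different ones. Along it the first two coordinates are multiples of \<open>exp u - k exp (- u)\<close>
  with \<open>k = 1 + t\<^sup>2\<close> and \<open>k = 1 - t\<^sup>2\<close>, and the factors \<open>sin (Im w)\<close> and \<open>cos (Im w)\<close> do not vanish
  together.\<close>
lemma inj_universal_covering_map:
  assumes "- 1 < t" "t < 1" "lam \<noteq> 0" "Re lam = 0"
  shows "inj (universal_covering_map t lam)"
proof (rule injI)
  fix w w' assume eq: "universal_covering_map t lam w = universal_covering_map t lam w'"
  define m where "m = Im lam"
  have m: "lam = \<i> * of_real m" "m \<noteq> 0"
    using assms(3,4) by (auto simp: m_def complex_eq_iff)
  have comp: "universal_covering_map t lam w $ 1 = - 2 * m * (sin (Im w) * (exp (Re w) - (t\<^sup>2 + 1) * exp (- Re w)))"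
    "universal_covering_map t lam w $ 2 = 2 * m * (cos (Im w) * (exp (Re w) - (1 - t\<^sup>2) * exp (- Re w)))"
    "universal_covering_map t lam w $ 3 = - 4 * m * Im w" for w
  proof -
    have rotate: "Re (\<i> * of_real m * v) = - m * Im v" "Im (\<i> * of_real m * v) = m * Re v" for v
      by simp_all
    have lin: "Re (u + of_real k * v) = Re u + k * Re v" "Im (u + of_real k * v) = Im u + k * Im v" for k u v
      by simp_all
    have inv: "of_real k / exp w = of_real k * exp (- w)" for k
      by (simp add: exp_minus field_simps)
    show "universal_covering_map t lam w $ 1 = - 2 * m * (sin (Im w) * (exp (Re w) - (t\<^sup>2 + 1) * exp (- Re w)))"
      "universal_covering_map t lam w $ 2 = 2 * m * (cos (Im w) * (exp (Re w) - (1 - t\<^sup>2) * exp (- Re w)))"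
      "universal_covering_map t lam w $ 3 = - 4 * m * Im w"
      unfolding universal_covering_map_def catenoid_primitive_components m inv rotate lin
      by (simp_all add: Re_exp Im_exp algebra_simps)
  qed
  have Im: "Im w = Im w'"
    using arg_cong[OF eq, of "\<lambda>x. x $ 3"] m(2) by (simp add: comp)
  have "t\<^sup>2 < 1"
    using assms by (simp add: abs_square_less_1)
  then have k: "0 < t\<^sup>2 + 1" "0 < 1 - t\<^sup>2"
    by (auto intro: add_nonneg_pos)
  have "Re w = Re w'"
  proof (cases "sin (Im w') = 0")
    case False
    then have "exp (Re w) - (t\<^sup>2 + 1) * exp (- Re w) = exp (Re w') - (t\<^sup>2 + 1) * exp (- Re w')"
      using arg_cong[OF eq, of "\<lambda>x. x $ 1"] m(2) unfolding comp Im by simp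
    then show ?thesis
      using strict_mono_eq[OF strict_mono_exp_minus_exp_neg[OF k(1)]] by blast
  next
    case True
    then have "cos (Im w') \<noteq> 0"
      using sin_cos_squared_add[of "Im w'"] by auto
    then have "exp (Re w) - (1 - t\<^sup>2) * exp (- Re w) = exp (Re w') - (1 - t\<^sup>2) * exp (- Re w')"
      using arg_cong[OF eq, of "\<lambda>x. x $ 2"] m(2) unfolding comp Im by simp
    then show ?thesis
      using strict_mono_eq[OF strict_mono_exp_minus_exp_neg[OF k(2)]] by blast
  qed
  with Im show "w = w'"
    by (simp add: complex_eq_iff)
qed

section \<open>Double points near the end\<close>

text \<open>With \<open>x = 2 \<lambda> sinh d\<close> real, the differences of the holomorphic coordinates at \<open>w\<^sub>0 + d\<close> and
  \<open>w\<^sub>0 - d\<close> are \<open>\<i> (R + (t\<^sup>2 + 1) / R) x\<close>, \<open>(R + (t\<^sup>2 - 1) / R) x\<close>, \<open>4 \<lambda> d\<close> and \<open>2 t \<i> x / R\<close>. All but the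
  second are purely imaginary, and the choice of \<open>R\<close> makes the second vanish.\<close>
lemma universal_covering_map_symmetric_eq:
  assumes R: "0 < R" "R\<^sup>2 = 1 - t\<^sup>2"
    and d: "Re (lam * d) = 0" "Im (lam * (exp d - exp (- d))) = 0"
    and w0: "exp w0 = \<i> * of_real R"
  shows "universal_covering_map t lam (w0 + d) = universal_covering_map t lam (w0 - d)"
proof -
  define x where "x = Re (lam * (exp d - exp (- d)))"
  have x: "lam * (exp d - exp (- d)) = of_real x"
    using d(2) by (simp add: x_def complex_eq_iff)
  have exp: "exp (w0 + d) = \<i> * of_real R * exp d" "exp (w0 - d) = \<i> * of_real R * exp (- d)"
    by (simp_all add: exp_add exp_diff exp_minus w0 field_simps)
  have inv: "1 / exp (w0 + d) = - \<i> / of_real R * exp (- d)" "1 / exp (w0 - d) = - \<i> / of_real R * exp d"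
    unfolding exp using R(1) by (simp_all add: exp_minus field_simps)
  have diff: "lam * (exp (w0 + d) + of_real k / exp (w0 + d)) - lam * (exp (w0 - d) + of_real k / exp (w0 - d))
      = \<i> * of_real ((R + k / R) * x)" for k
  proof -
    have "lam * (exp (w0 + d) + of_real k / exp (w0 + d)) - lam * (exp (w0 - d) + of_real k / exp (w0 - d))
        = lam * (exp (w0 + d) + of_real k * (1 / exp (w0 + d))) - lam * (exp (w0 - d) + of_real k * (1 / exp (w0 - d)))"
      by simp
    also have "\<dots> = \<i> * of_real (R + k / R) * (lam * (exp d - exp (- d)))"
      unfolding inv unfolding exp by (simp add: algebra_simps)
    finally show ?thesis
      unfolding x by simp
  qed
  have "universal_covering_map t lam (w0 + d) $ 1 = universal_covering_map t lam (w0 - d) $ 1"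
    using arg_cong[OF diff, of Re "t\<^sup>2 + 1"]
    unfolding universal_covering_map_def catenoid_primitive_components minus_complex.sel by simp
  moreover have "R + (t\<^sup>2 - 1) / R = 0"
    using R by (simp add: power2_eq_square field_simps)
  then have "universal_covering_map t lam (w0 + d) $ 2 = universal_covering_map t lam (w0 - d) $ 2"
    using arg_cong[OF diff, of Im "t\<^sup>2 - 1"]
    unfolding universal_covering_map_def catenoid_primitive_components minus_complex.sel by simp
  moreover have "universal_covering_map t lam (w0 + d) $ 3 = universal_covering_map t lam (w0 - d) $ 3"
    using d(1) unfolding universal_covering_map_def catenoid_primitive_components
    by (simp add: algebra_simps)
  moreover have "universal_covering_map t lam (w0 + d) $ 4 = universal_covering_map t lam (w0 - d) $ 4"
  proof -
    have "lam / exp (w0 + d) - lam / exp (w0 - d) = lam * (1 / exp (w0 + d)) - lam * (1 / exp (w0 - d))"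
      by simp
    also have "\<dots> = \<i> / of_real R * (lam * (exp d - exp (- d)))"
      unfolding inv by (simp add: algebra_simps)
    also have "\<dots> = \<i> * of_real (x / R)"
      unfolding x by simp
    finally have "Re (lam / exp (w0 + d) - lam / exp (w0 - d)) = 0"
      by simp
    then show ?thesis
      unfolding universal_covering_map_def catenoid_primitive_components minus_complex.sel by simp
  qed
  ultimately show ?thesis
    by (simp add: vec_eq_iff forall_4)
qed

text \<open>At \<open>s a = \<pi>/2\<close> and \<open>s a = 3\<pi>/2\<close> modulo \<open>2\<pi>\<close> the cosine term vanishes and the sine term
  takes opposite signs.\<close>
lemma cosh_sin_sinh_cos_unbounded_zeros:
  fixes a b M :: real
  assumes "a \<noteq> 0"
  obtains s where "s > M" "a * (cosh (s * b) * sin (s * a)) + b * (sinh (s * b) * cos (s * a)) = 0"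
proof -
  \<comment> \<open>The left-hand side is even in \<open>a\<close>, so \<open>a\<close> may be taken positive.\<close>
  define c where "c = \<bar>a\<bar>"
  have c: "c > 0"
    using assms by (simp add: c_def)
  define f where "f s = c * (cosh (s * b) * sin (s * c)) + b * (sinh (s * b) * cos (s * c))" for s
  have f_eq: "f s = a * (cosh (s * b) * sin (s * a)) + b * (sinh (s * b) * cos (s * a))" for s
    by (cases "a \<ge> 0") (simp_all add: f_def c_def)
  obtain n :: nat where n: "M * c < real n"
    using reals_Archimedean2 by blast
  define s1 where "s1 = (pi / 2 + 2 * real n * pi) / c"
  define s2 where "s2 = (3 / 2 * pi + 2 * real n * pi) / c"
  have sc: "s1 * c = pi / 2 + 2 * real n * pi" "s2 * c = 3 / 2 * pi + 2 * real n * pi"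
    using c by (simp_all add: s1_def s2_def)
  have trig: "sin (s1 * c) = 1" "cos (s1 * c) = 0" "sin (s2 * c) = - 1" "cos (s2 * c) = 0"
    unfolding sc sin_add cos_add using sin_3over2_pi cos_3over2_pi by simp_all
  have "\<exists>s\<ge>s1. s \<le> s2 \<and> f s = 0"
  proof (rule IVT2')
    show "f s2 \<le> 0" "0 \<le> f s1"
      unfolding f_def trig using c by simp_all
    show "s1 \<le> s2"
      unfolding s1_def s2_def using c by (intro divide_right_mono) auto
    show "continuous_on {s1..s2} f"
      unfolding f_def cosh_def sinh_def by (intro continuous_intros)
  qed
  then obtain s where s: "s1 \<le> s" "f s = 0"
    by blast
  have "real n \<le> 2 * real n * pi"
    using mult_left_mono[of 1 "2 * pi" "real n"] pi_gt3 by (simp add: ac_simps)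
  then have "M * c < s1 * c"
    unfolding sc using n pi_gt_zero by linarith
  then have "M < s1"
    using c by simp
  with s(1) have "M < s"
    by simp
  with s(2) show thesis
    using that f_eq by simp
qed

lemma universal_covering_map_double_points_at_infinity:
  assumes "- 1 < t" "t < 1" "Re lam \<noteq> 0" "Im lam \<noteq> 0"
  obtains p q where "p \<noteq> q" "universal_covering_map t lam p = universal_covering_map t lam q"
    "cmod p > B" "cmod q > B"
proof -
  define R where "R = sqrt (1 - t\<^sup>2)"
  have "t\<^sup>2 < 1"
    using assms by (simp add: abs_square_less_1)
  then have R: "0 < R" "R\<^sup>2 = 1 - t\<^sup>2"
    by (simp_all add: R_def)
  define w0 where "w0 = Ln (\<i> * of_real R)"
  have w0: "exp w0 = \<i> * of_real R"
    using R(1) by (simp add: w0_def)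
  let ?M = "max 0 ((B + cmod w0) / cmod lam)"
  obtain s where s: "s > ?M"
    "Re lam * (cosh (s * Im lam) * sin (s * Re lam)) + Im lam * (sinh (s * Im lam) * cos (s * Re lam)) = 0"
    using cosh_sin_sinh_cos_unbounded_zeros[OF assms(3)] .
  \<comment> \<open>The general solution of \<open>Re (\<lambda> d) = 0\<close>; large \<open>s\<close> pushes both points \<open>w\<^sub>0 \<plusminus> d\<close> to infinity.\<close>
  define d where "d = \<i> * of_real s * cnj lam"
  have lam: "cmod lam > 0"
    using assms(3) by auto
  have norm_d: "cmod d > B + cmod w0" "d \<noteq> 0"
    using s(1) lam by (auto simp: d_def norm_mult pos_divide_less_eq)
  have "Re (lam * d) = 0"
    by (simp add: d_def algebra_simps)
  moreover have "Im (lam * (exp d - exp (- d))) = 0"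
  proof -
    have d_Re_Im: "Re d = s * Im lam" "Im d = s * Re lam"
      by (simp_all add: d_def)
    have "Re (exp d - exp (- d)) = 2 * (sinh (s * Im lam) * cos (s * Re lam))"
      "Im (exp d - exp (- d)) = 2 * (cosh (s * Im lam) * sin (s * Re lam))"
      by (simp_all add: Re_exp Im_exp d_Re_Im sinh_def cosh_def algebra_simps)
    then have "Im (lam * (exp d - exp (- d))) =
        2 * (Re lam * (cosh (s * Im lam) * sin (s * Re lam)) + Im lam * (sinh (s * Im lam) * cos (s * Re lam)))"
      unfolding times_complex.sel by (simp only: distrib_left mult.left_commute)
    then show ?thesis
      using s(2) by simp
  qed
  ultimately have "universal_covering_map t lam (w0 + d) = universal_covering_map t lam (w0 - d)"
    using universal_covering_map_symmetric_eq[OF R _ _ w0] by blast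
  moreover have "cmod (w0 + d) > B" "cmod (w0 - d) > B"
    using norm_d(1) norm_triangle_ineq2[of d "- w0"] norm_triangle_ineq2[of d w0]
    by (simp_all add: add.commute norm_minus_commute)
  moreover have "w0 + d \<noteq> w0 - d"
    using norm_d(2) by (simp add: eq_neg_iff_add_eq_0 diff_conv_add_uminus del: add_uminus_conv_diff)
  ultimately show thesis
    using that by blast
qed

section \<open>The associated family\<close>

theorem proposition7p8:
  fixes t :: real and lam :: complex
  assumes "- 1 < t" and "t < 1" and "lam \<noteq> 0"
  shows
    "(lam \<in> \<real> \<longrightarrow>
        (\<exists>X. surface_on_punctured_plane t lam X) \<and>
        (\<forall>X. surface_on_punctured_plane t lam X \<longrightarrow>
           stationary_surface_on (- {0}) X \<and> embedded_on (- {0}) X)) \<and>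
     (Re lam = 0 \<longrightarrow>
        (\<exists>X. surface_on_universal_covering t lam X) \<and>
        (\<forall>X. surface_on_universal_covering t lam X \<longrightarrow>
           stationary_surface_on UNIV X \<and> embedded_on UNIV X)) \<and>
     (lam \<notin> \<real> \<and> Re lam \<noteq> 0 \<longrightarrow>
        simply_connected (UNIV :: complex set) \<and>
        (\<exists>X. surface_on_universal_covering t lam X) \<and>
        (\<forall>X. surface_on_universal_covering t lam X \<longrightarrow>
           stationary_surface_on UNIV X \<and> has_self_intersection_on UNIV X \<and> \<not> embedded_end X))"
proof (intro conjI impI allI)
  assume "lam \<in> \<real>"
  note iff = surface_on_punctured_plane_iff[OF this]
  show "\<exists>X. surface_on_punctured_plane t lam X"
    unfolding iff by (intro exI[of _ "punctured_plane_map t lam"] exI[of _ 0]) simp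
  fix X assume "surface_on_punctured_plane t lam X"
  then obtain c where X: "\<And>z. z \<noteq> 0 \<Longrightarrow> X z = c + punctured_plane_map t lam z"
    unfolding iff by auto
  show "stationary_surface_on (- {0}) X"
    using stationary_surface_on_punctured_plane[OF assms \<open>lam \<in> \<real>\<close> X] .
  show "embedded_on (- {0}) X"
    using inj_punctured_plane_map[OF assms \<open>lam \<in> \<real>\<close>]
    by (auto simp: embedded_on_def has_self_intersection_on_def X inj_on_def)
next
  show "\<exists>X. surface_on_universal_covering t lam X"
    unfolding surface_on_universal_covering_iff
    by (intro exI[of _ "universal_covering_map t lam"] exI[of _ 0]) simp
  then show "\<exists>X. surface_on_universal_covering t lam X" .
  show "simply_connected (UNIV :: complex set)"
    by (simp add: convex_imp_simply_connected)
  fix X assume "surface_on_universal_covering t lam X"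
  then obtain c where X: "\<And>w. X w = c + universal_covering_map t lam w"
    unfolding surface_on_universal_covering_iff by auto
  show "stationary_surface_on UNIV X"
    using stationary_surface_on_universal_covering[OF assms X] .
  then show "stationary_surface_on UNIV X" .
  show "embedded_on UNIV X" if "Re lam = 0"
    using inj_universal_covering_map[OF assms that]
    by (auto simp: embedded_on_def has_self_intersection_on_def X inj_def)
  assume lam: "lam \<notin> \<real> \<and> Re lam \<noteq> 0"
  then have nonzero: "Re lam \<noteq> 0" "Im lam \<noteq> 0"
    by (auto simp: complex_is_Real_iff)
  have double: "\<exists>p q. p \<noteq> q \<and> X p = X q \<and> cmod p > B \<and> cmod q > B" for B
    unfolding X add_left_cancel
    using universal_covering_map_double_points_at_infinity[OF assms(1,2) nonzero] by metis
  show "has_self_intersection_on UNIV X"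
    using double[of 0] by (auto simp: has_self_intersection_on_def)
  show "\<not> embedded_end X"
  proof
    assume "embedded_end X"
    then obtain K where "compact K" and inj: "inj_on X (- K)"
      by (auto simp: embedded_end_def)
    then obtain B where B: "\<And>w. w \<in> K \<Longrightarrow> cmod w \<le> B"
      using compact_imp_bounded[of K] by (auto simp: bounded_iff)
    obtain p q where "p \<noteq> q" "X p = X q" "cmod p > B" "cmod q > B"
      using double by blast
    moreover from this have "p \<in> - K" "q \<in> - K"
      using B by force+
    ultimately show False
      using inj by (auto dest: inj_onD)
  qed
qed

end
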